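(* Let $\mathsf{B}=\{B_1,B_2,\ldots,B_N\}$ be a finite set of $2\times 2$ complex matrices whose joint spectral radius satisfies $\varrho(\mathsf{B})\neq 0$. Define \[b_n:=\max_{1\leq i_1,\ldots,i_n\leq N}\|B_{i_1}\cdots B_{i_n}\|\] for every $n\geq 1$. Then either the sequence $\left(b_n/\varrho(\mathsf{B})^n\right)_{n\geq 1}$ is bounded away from zero and infinity, or the sequence $\left(b_n/(n\varrho(\mathsf{B})^n)\right)_{n\geq 1}$ is bounded away from zero and infinity.
   Context: $\|\cdot\|$ denotes the Euclidean operator norm on $2\times 2$ complex matrices. The joint spectral radius of a finite nonempty set $\mathsf{B}=\{B_1,\ldots,B_N\}$ of matrices is \[\varrho(\mathsf{B}):=\lim_{n\to\infty}\max_{1\leq i_1,\ldots,i_n\leq N}\|B_{i_n}\cdots B_{i_1}\|^{1/n}=\inf_{n\geq 1}\max_{1\leq i_1,\ldots,i_n\leq N}\|B_{i_n}\cdots B_{i_1}\|^{1/n}.\] A sequence of positive reals $(x_n)$ is bounded away from zero and infinity if there exist constants $0<c\leq C<\infty$ with $c\leq x_n\leq C$ for all $n\geq 1$. *)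

theory Defs
  imports "HOL-Analysis.Analysis"
begin

text \<open>The type \<open>complex ^ 'n\<close> carries the Euclidean norm, so \<open>onorm\<close> of the map
  \<open>v \<mapsto> A v\<close> is the Euclidean operator norm (the supremum is over complex vectors).
  Note that \<open>norm A\<close> itself would be the Frobenius norm.\<close>

definition mat_onorm :: "complex ^ 'n ^ 'n \<Rightarrow> real" where
  "mat_onorm A = onorm (\<lambda>v. A *v v)"

text \<open>\<open>mat_prod [A\<^sub>1, \<dots>, A\<^sub>n] = A\<^sub>1 \<cdots> A\<^sub>n\<close>\<close>

definition mat_prod :: "(complex ^ 'n ^ 'n) list \<Rightarrow> complex ^ 'n ^ 'n" where
  "mat_prod As = foldr (**) As (mat 1)"

definition words :: "'a set \<Rightarrow> nat \<Rightarrow> 'a list set" where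
  "words B n = {As. set As \<subseteq> B \<and> length As = n}"

text \<open>For finite nonempty \<open>B\<close> the maxima below are over finite nonempty sets. A word
  \<open>[B\<^sub>i\<^sub>1, \<dots>, B\<^sub>i\<^sub>n]\<close> is multiplied from right to left, \<open>B\<^sub>i\<^sub>n \<cdots> B\<^sub>i\<^sub>1\<close>, in the joint spectral
  radius and from left to right, \<open>B\<^sub>i\<^sub>1 \<cdots> B\<^sub>i\<^sub>n\<close>, in \<open>max_prod_norm\<close>.\<close>

definition joint_spectral_radius :: "(complex ^ 'n ^ 'n) set \<Rightarrow> real" where
  "joint_spectral_radius B =
     lim (\<lambda>n. Max ((\<lambda>As. root n (mat_onorm (mat_prod (rev As)))) ` words B n))"

definition max_prod_norm :: "(complex ^ 'n ^ 'n) set \<Rightarrow> nat \<Rightarrow> real" where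
  "max_prod_norm B n = Max ((\<lambda>As. mat_onorm (mat_prod As)) ` words B n)"

definition bounded_away_zero_infinity :: "(nat \<Rightarrow> real) \<Rightarrow> bool" where
  "bounded_away_zero_infinity x \<longleftrightarrow>
     (\<exists>c C. 0 < c \<and> c \<le> C \<and> (\<forall>n\<ge>1. c \<le> x n \<and> x n \<le> C))"

end

theory Submission
  imports Defs
begin

text \<open>
  After division by the joint spectral radius one may assume that it is 1. Let \<open>b n\<close> be the maximal
  norm of a product of length \<open>n\<close>. Fekete's lemma, applied to this submultiplicative sequence,
  says that \<open>b n \<ge> 1\<close> for all \<open>n \<ge> 1\<close> and that \<open>b n\<close> grows subexponentially. If \<open>b\<close> is bounded, the first alternative holds. It remains to
  show that an unbounded \<open>b\<close> grows exactly linearly.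

  Consider the vectors whose orbit under all products is bounded; they form an invariant
  subspace. It is not zero: otherwise, by compactness of the unit sphere, every vector could be
  doubled in length by a word of bounded length, and \<open>b\<close> would grow exponentially
  (\<open>exists_bounded_orbit\<close>). It is not everything, since \<open>b\<close> is unbounded. So it is a line, spanned
  by a common eigenvector (\<open>common_eigenvector\<close>), and the matrices can be taken upper triangular,
  with diagonal entries \<open>a\<close>, \<open>d\<close> of modulus at most 1 and upper right entry \<open>c\<close>.

  The upper right entry of a product is at most linear in the length. To see that it is either
  bounded or really attains linear size (\<open>tri_offdiag_dichotomy\<close>), look at the letters with
  \<open>|a| = |d| = 1\<close>. If they can be diagonalized by one unipotent conjugation, then the inequality
  \<open>|c| \<le> K (2 - |a| - |d|)\<close> holds for all letters with some \<open>K\<close> and is inherited by products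
  (\<open>tri_offdiag_bounded\<close>), so that the products are bounded. If they cannot, then there is
  a nondiagonal letter with \<open>a = d\<close>, whose powers grow linearly, or there are two letters \<open>x\<close>,
  \<open>y\<close> that do not commute. In the latter case a suitable concatenation of blocks \<open>xy\<close> and \<open>yx\<close>
  has linear size (\<open>tri_offdiag_noncommuting\<close>).
\<close>

section \<open>Submultiplicative and subexponential sequences\<close>

text \<open>Write \<open>n = q m + r\<close> with \<open>r < m\<close>: submultiplicativity costs \<open>f m \<le> s ^ m\<close> for each of the
  \<open>q\<close> full blocks, and the remainder only contributes to the constant.\<close>

lemma submultiplicative_growth:
  fixes f :: "nat \<Rightarrow> real"
  assumes nonneg: "\<And>n. 0 \<le> f n" and submult: "\<And>m n. f (m + n) \<le> f m * f n"
    and "0 < s" "0 < m" "f m \<le> s ^ m"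
  obtains K where "0 < K" "\<And>n. f n \<le> K * s ^ n"
proof -
  define K where "K = 1 + (\<Sum>r<m. f r / s ^ r)"
  have sum_nonneg: "0 \<le> (\<Sum>r<m. f r / s ^ r)"
    using nonneg \<open>0 < s\<close> by (intro sum_nonneg) auto
  have multiples: "f (q * m + r) \<le> (s ^ m) ^ q * f r" for q r
  proof (induction q)
    case (Suc q)
    have "f (Suc q * m + r) \<le> f m * f (q * m + r)"
      using submult[of m "q * m + r"] by (simp add: add.assoc)
    also have "\<dots> \<le> s ^ m * ((s ^ m) ^ q * f r)"
      using Suc nonneg assms by (intro mult_mono) auto
    finally show ?case by simp
  qed simp
  have "f n \<le> K * s ^ n" for n
  proof -
    define r where "r = n mod m"
    have r: "r < m" using \<open>0 < m\<close> by (simp add: r_def)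
    have n: "n = n div m * m + r" by (simp add: r_def)
    have "f r / s ^ r \<le> (\<Sum>r<m. f r / s ^ r)"
      using r nonneg \<open>0 < s\<close> by (intro member_le_sum) auto
    then have "f r \<le> K * s ^ r"
      using \<open>0 < s\<close> by (simp add: K_def field_simps) (smt (verit) zero_less_power)
    then have "f n \<le> (s ^ m) ^ (n div m) * (K * s ^ r)"
      using multiples[of "n div m" r] n \<open>0 < s\<close>
      by (smt (verit) mult_left_mono zero_less_power)
    also have "\<dots> = K * s ^ (n div m * m + r)"
      by (simp add: power_mult power_add mult.commute)
    finally show ?thesis using n by simp
  qed
  moreover have "0 < K" using sum_nonneg by (simp add: K_def)
  ultimately show ?thesis using that by blast
qed

text \<open>Multiplicative form of Fekete's lemma. Values \<open>f n = 0\<close> are allowed, so that the lemma also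
  covers sets of matrices all of whose long products vanish.\<close>

lemma submultiplicative_root_limit:
  fixes f :: "nat \<Rightarrow> real"
  assumes nonneg: "\<And>n. 0 \<le> f n" and submult: "\<And>m n. f (m + n) \<le> f m * f n"
  obtains L where "0 \<le> L" "(\<lambda>n. root n (f n)) \<longlonglongrightarrow> L" "\<And>n. 0 < n \<Longrightarrow> L ^ n \<le> f n"
proof -
  define L where "L = (INF n\<in>{0<..}. root n (f n))"
  have bdd: "bdd_below ((\<lambda>n. root n (f n)) ` {0<..})"
    using nonneg by (intro bdd_belowI[of _ 0]) auto
  have L0: "0 \<le> L"
    unfolding L_def using nonneg by (intro cINF_greatest) auto
  have lower: "L \<le> root n (f n)" if "0 < n" for n
    unfolding L_def using bdd that by (intro cINF_lower) auto
  have "(\<lambda>n. root n (f n)) \<longlonglongrightarrow> L"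
  proof (rule order_tendstoI)
    fix y assume "y < L"
    have "y < root n (f n)" if "1 \<le> n" for n
      using \<open>y < L\<close> lower[of n] that by simp
    then show "\<forall>\<^sub>F n in sequentially. y < root n (f n)"
      by (rule eventually_sequentiallyI)
  next
    fix y assume "L < y"
    then obtain s where s: "L < s" "s < y" using dense by blast
    then obtain m where m: "0 < m" "root m (f m) < s"
      using cINF_less_iff[OF _ bdd] by (auto simp: L_def)
    have "f m = root m (f m) ^ m" using m nonneg by simp
    also have "\<dots> \<le> s ^ m" using m nonneg by (intro power_mono) auto
    finally have fm: "f m \<le> s ^ m" .
    have "0 < s" using L0 s by simp
    then obtain K where K: "0 < K" "\<And>n. f n \<le> K * s ^ n"
      using submultiplicative_growth[of f, OF nonneg submult _ m(1) fm] by metis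
    have "(\<lambda>n. root n K * s) \<longlonglongrightarrow> 1 * s"
      using LIMSEQ_root_const[OF K(1)] by (intro tendsto_intros)
    then have upper: "\<forall>\<^sub>F n in sequentially. root n K * s < y"
      using s by (intro order_tendstoD) auto
    have "root n (f n) \<le> root n K * s" if "0 < n" for n
      using real_root_le_mono[OF that K(2)[of n]] that L0 s
      by (simp add: real_root_mult real_root_power_cancel)
    then have "\<forall>\<^sub>F n in sequentially. root n (f n) \<le> root n K * s"
      by (rule eventually_mono[OF eventually_gt_at_top[of 0]])
    with upper show "\<forall>\<^sub>F n in sequentially. root n (f n) < y"
      by eventually_elim (rule le_less_trans)
  qed
  moreover have "L ^ n \<le> f n" if "0 < n" for n
    using power_mono[OF lower[OF that] L0, of n] that nonneg by simp
  ultimately show ?thesis using that L0 by blast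
qed

text \<open>Comparing with \<open>s = sqrt x\<close> is enough: if \<open>x > 1\<close> then \<open>x ^ n\<close> is the square of \<open>sqrt x ^ n\<close>,
  which is unbounded.\<close>

lemma le_1_if_powers_subexponential:
  fixes x :: real
  assumes "0 \<le> x" and "\<And>s. 1 < s \<Longrightarrow> \<exists>K. \<forall>n. x ^ n \<le> K * s ^ n"
  shows "x \<le> 1"
proof (rule ccontr)
  assume "\<not> x \<le> 1"
  then have x: "1 < x" by simp
  then have s: "1 < sqrt x" by simp
  then obtain K where K: "\<And>n. x ^ n \<le> K * sqrt x ^ n" using assms(2) by blast
  obtain n where n: "K < sqrt x ^ n" using s real_arch_pow by blast
  have "x ^ n = sqrt x ^ n * sqrt x ^ n"
    using x by (simp flip: power_mult_distrib)
  moreover have "K * sqrt x ^ n < sqrt x ^ n * sqrt x ^ n"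
    using n s by (intro mult_strict_right_mono) auto
  ultimately show False using K[of n] by simp
qed

section \<open>Operator norms of products along words\<close>

lemma norm_mat_mult_le: "norm (A *v x) \<le> mat_onorm A * norm x"
  unfolding mat_onorm_def by (intro onorm matrix_vector_mul_bounded_linear)

lemma mat_onorm_leI: "(\<And>x. norm (A *v x) \<le> b * norm x) \<Longrightarrow> mat_onorm A \<le> b"
  unfolding mat_onorm_def by (rule onorm_le)

lemma mat_onorm_nonneg: "0 \<le> mat_onorm A"
  unfolding mat_onorm_def by (intro onorm_pos_le matrix_vector_mul_bounded_linear)

lemma mat_onorm_mult: "mat_onorm (A ** A') \<le> mat_onorm A * mat_onorm A'"
proof (rule mat_onorm_leI)
  fix x
  have "norm (A *v (A' *v x)) \<le> mat_onorm A * (mat_onorm A' * norm x)"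
    by (meson mat_onorm_nonneg mult_left_mono norm_mat_mult_le order_trans)
  then show "norm (A ** A' *v x) \<le> mat_onorm A * mat_onorm A' * norm x"
    by (simp add: matrix_vector_mul_assoc mult.assoc)
qed

lemma scaleR_mat_mult: "(r *\<^sub>R A) *v x = r *\<^sub>R (A *v x)" for A :: "complex ^ 'n ^ 'm"
  by (simp add: vec_eq_iff matrix_vector_mult_def scaleR_sum_right)

lemma mat_onorm_scaleR: "mat_onorm (r *\<^sub>R A) = \<bar>r\<bar> * mat_onorm A"
  unfolding mat_onorm_def scaleR_mat_mult
  by (rule onorm_scaleR[OF matrix_vector_mul_bounded_linear])

lemma norm_entry_le_mat_onorm: "norm (A $ i $ j) \<le> mat_onorm A"
proof -
  have "norm ((A *v axis j 1) $ i) \<le> norm (A *v axis j 1)"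
    by (rule Finite_Cartesian_Product.norm_nth_le)
  also have "\<dots> \<le> mat_onorm A * norm (axis j (1::complex))" by (rule norm_mat_mult_le)
  also have "(A *v axis j 1) $ i = A $ i $ j"
    by (simp add: matrix_vector_mult_def axis_def if_distrib cong: if_cong)
  finally show ?thesis by simp
qed

lemma mat_onorm_le_sum_entries: "mat_onorm A \<le> (\<Sum>i\<in>UNIV. \<Sum>j\<in>UNIV. norm (A $ i $ j))"
proof (rule mat_onorm_leI)
  fix x :: "complex ^ 'a"
  have "norm (A *v x) \<le> (\<Sum>i\<in>UNIV. norm ((A *v x) $ i))"
    unfolding norm_vec_def by (intro L2_set_le_sum) simp
  also have "\<dots> \<le> (\<Sum>i\<in>UNIV. \<Sum>j\<in>UNIV. norm (A $ i $ j) * norm x)"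
    unfolding matrix_vector_mult_def
    by (auto intro!: sum_mono norm_sum[THEN order_trans] mult_left_mono
        Finite_Cartesian_Product.norm_nth_le simp: norm_mult)
  finally show "norm (A *v x) \<le> (\<Sum>i\<in>UNIV. \<Sum>j\<in>UNIV. norm (A $ i $ j)) * norm x"
    by (simp add: sum_distrib_right)
qed

lemma mat_prod_Nil [simp]: "mat_prod [] = mat 1"
  and mat_prod_Cons [simp]: "mat_prod (A # w) = A ** mat_prod w"
  by (simp_all add: mat_prod_def)

lemma mat_prod_append: "mat_prod (u @ v) = mat_prod u ** mat_prod v"
  by (induction u) (simp_all add: matrix_mul_assoc)

lemma mat_prod_map_scaleR:
  "mat_prod (map (\<lambda>A. r *\<^sub>R A) w) = r ^ length w *\<^sub>R mat_prod w"
  by (induction w) (simp_all add: matrix_scalar_ac scalar_matrix_assoc mult.commute)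

lemma finite_words: "finite B \<Longrightarrow> finite (words B n)"
  unfolding words_def by (rule finite_lists_length_eq)

lemma words_nonempty:
  assumes "B \<noteq> {}" shows "words B n \<noteq> {}"
proof -
  obtain A where "A \<in> B" using assms by blast
  then have "replicate n A \<in> words B n" by (auto simp: words_def)
  then show ?thesis by blast
qed

lemma mat_onorm_le_max_prod_norm:
  assumes "finite B" "w \<in> words B n"
  shows "mat_onorm (mat_prod w) \<le> max_prod_norm B n"
  unfolding max_prod_norm_def using assms by (intro Max_ge finite_imageI finite_words imageI)

lemma max_prod_norm_le_iff:
  assumes "finite B" "B \<noteq> {}"
  shows "max_prod_norm B n \<le> b \<longleftrightarrow> (\<forall>w\<in>words B n. mat_onorm (mat_prod w) \<le> b)"
  unfolding max_prod_norm_def using finite_words[OF assms(1)] words_nonempty[OF assms(2)]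
  by (subst Max_le_iff) auto

lemma max_prod_norm_nonneg:
  assumes "finite B" "B \<noteq> {}"
  shows "0 \<le> max_prod_norm B n"
  using mat_onorm_le_max_prod_norm[OF assms(1)] words_nonempty[OF assms(2)] mat_onorm_nonneg
  by (meson ex_in_conv order_trans)

lemma max_prod_norm_submult:
  assumes "finite B" "B \<noteq> {}"
  shows "max_prod_norm B (m + n) \<le> max_prod_norm B m * max_prod_norm B n"
  unfolding max_prod_norm_le_iff[OF assms]
proof
  fix w assume w: "w \<in> words B (m + n)"
  have "take m w \<in> words B m" "drop m w \<in> words B n"
    using w by (auto simp: words_def dest: in_set_takeD in_set_dropD)
  then have "mat_onorm (mat_prod (take m w)) * mat_onorm (mat_prod (drop m w))
      \<le> max_prod_norm B m * max_prod_norm B n"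
    using assms by (intro mult_mono mat_onorm_le_max_prod_norm mat_onorm_nonneg max_prod_norm_nonneg)
  then show "mat_onorm (mat_prod w) \<le> max_prod_norm B m * max_prod_norm B n"
    using mat_onorm_mult[of "mat_prod (take m w)" "mat_prod (drop m w)"]
    by (simp flip: mat_prod_append)
qed

text \<open>Reversal permutes the words of each length, so the order of multiplication does not matter
  after taking the maximum; and \<open>root n\<close>, being monotone, commutes with the maximum.\<close>

lemma joint_spectral_radius_eq_lim:
  assumes "finite B" "B \<noteq> {}"
  shows "joint_spectral_radius B = lim (\<lambda>n. root n (max_prod_norm B n))"
proof -
  have rev: "rev ` words B n = words B n" for n
  proof
    show "words B n \<subseteq> rev ` words B n"
    proof
      fix w assume "w \<in> words B n"
      then have "rev w \<in> words B n" "w = rev (rev w)" by (auto simp: words_def)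
      then show "w \<in> rev ` words B n" by blast
    qed
  qed (auto simp: words_def)
  have "Max ((\<lambda>w. root n (mat_onorm (mat_prod (rev w)))) ` words B n)
      = root n (max_prod_norm B n)" for n
  proof -
    have "mono (root n)"
      by (cases "n = 0") (auto intro!: monoI simp: real_root_le_mono)
    then have "root n (max_prod_norm B n) =
        Max (root n ` (\<lambda>w. mat_onorm (mat_prod w)) ` words B n)"
      unfolding max_prod_norm_def
      using assms by (intro mono_Max_commute) (simp_all add: finite_words words_nonempty)
    also have "\<dots> = Max (root n ` (\<lambda>w. mat_onorm (mat_prod w)) ` rev ` words B n)"
      by (simp add: rev)
    finally show ?thesis by (simp add: image_image)
  qed
  then show ?thesis by (simp add: joint_spectral_radius_def)
qed

lemma max_prod_norm_scaleR:
  assumes "finite B" "B \<noteq> {}" "0 \<le> r"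
  shows "max_prod_norm ((*\<^sub>R) r ` B) n = r ^ n * max_prod_norm B n"
proof -
  have words: "words ((*\<^sub>R) r ` B) n = map ((*\<^sub>R) r) ` words B n"
  proof
    show "words ((*\<^sub>R) r ` B) n \<subseteq> map ((*\<^sub>R) r) ` words B n"
    proof
      fix w assume w: "w \<in> words ((*\<^sub>R) r ` B) n"
      then have "w \<in> lists ((*\<^sub>R) r ` B)" by (auto simp: words_def)
      then obtain u where "u \<in> lists B" "w = map ((*\<^sub>R) r) u" by (auto simp: lists_image)
      then show "w \<in> map ((*\<^sub>R) r) ` words B n" using w by (auto simp: words_def)
    qed
  qed (force simp: words_def)
  have "mono ((*) (r ^ n))" using \<open>0 \<le> r\<close> by (intro monoI mult_left_mono) auto
  then have "r ^ n * max_prod_norm B n =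
      Max ((*) (r ^ n) ` (\<lambda>w. mat_onorm (mat_prod w)) ` words B n)"
    unfolding max_prod_norm_def
    using assms by (intro mono_Max_commute) (simp_all add: finite_words words_nonempty)
  also have "\<dots> = max_prod_norm ((*\<^sub>R) r ` B) n"
    unfolding max_prod_norm_def words image_image using \<open>0 \<le> r\<close>
    by (intro arg_cong[where f = Max] image_cong)
       (auto simp: mat_prod_map_scaleR mat_onorm_scaleR words_def)
  finally show ?thesis by simp
qed

section \<open>Growth of products and the joint spectral radius\<close>

text \<open>By Fekete's lemma the roots converge to their infimum. So every term is bounded below, and one
  index with root below \<open>s\<close> bounds all terms from above.\<close>

lemma joint_spectral_radius_growth:
  assumes "finite B" "B \<noteq> {}"
  shows "0 \<le> joint_spectral_radius B"
    and "0 < n \<Longrightarrow> joint_spectral_radius B ^ n \<le> max_prod_norm B n"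
    and "joint_spectral_radius B < s \<Longrightarrow> \<exists>K. \<forall>n. max_prod_norm B n \<le> K * s ^ n"
proof -
  note nonneg = max_prod_norm_nonneg[OF assms] and submult = max_prod_norm_submult[OF assms]
  obtain L where L: "0 \<le> L" "(\<lambda>n. root n (max_prod_norm B n)) \<longlonglongrightarrow> L"
    "\<And>n. 0 < n \<Longrightarrow> L ^ n \<le> max_prod_norm B n"
    using submultiplicative_root_limit[of "max_prod_norm B", OF nonneg submult] by metis
  have eq: "joint_spectral_radius B = L"
    using L(2) by (simp add: joint_spectral_radius_eq_lim[OF assms] limI)
  show "0 \<le> joint_spectral_radius B" "0 < n \<Longrightarrow> joint_spectral_radius B ^ n \<le> max_prod_norm B n"
    using L eq by auto
  assume "joint_spectral_radius B < s"
  then have s: "L < s" "0 < s" using L(1) eq by auto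
  then have "\<forall>\<^sub>F n in sequentially. root n (max_prod_norm B n) < s \<and> 0 < n"
    by (intro eventually_conj order_tendstoD(2)[OF L(2)] eventually_gt_at_top)
  then obtain m where m: "root m (max_prod_norm B m) < s" "0 < m"
    using eventually_happens'[OF sequentially_bot] by blast
  have "max_prod_norm B m \<le> s ^ m"
    using power_mono[of "root m (max_prod_norm B m)" s m] m nonneg[of m] by simp
  then show "\<exists>K. \<forall>n. max_prod_norm B n \<le> K * s ^ n"
    using submultiplicative_growth[of "max_prod_norm B", OF nonneg submult s(2) m(2)] by metis
qed

section \<open>A common eigenvector for unbounded products\<close>

text \<open>This is the form in which \<open>\<rho>(B) \<le> 1\<close> is used.\<close>

definition subexponential :: "(complex ^ 'n ^ 'n) set \<Rightarrow> bool" where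
  "subexponential B \<longleftrightarrow>
     (\<forall>s>1. \<exists>K. \<forall>w. set w \<subseteq> B \<longrightarrow> mat_onorm (mat_prod w) \<le> K * s ^ length w)"

lemma subexponentialE:
  assumes "subexponential B" "1 < s"
  obtains K where "\<And>w. set w \<subseteq> B \<Longrightarrow> mat_onorm (mat_prod w) \<le> K * s ^ length w"
proof -
  have "\<exists>K. \<forall>w. set w \<subseteq> B \<longrightarrow> mat_onorm (mat_prod w) \<le> K * s ^ length w"
    using assms unfolding subexponential_def by blast
  then show ?thesis using that by blast
qed

definition bounded_orbit :: "(complex ^ 'n ^ 'n) set \<Rightarrow> complex ^ 'n \<Rightarrow> bool" where
  "bounded_orbit B v \<longleftrightarrow> (\<exists>C. \<forall>w. set w \<subseteq> B \<longrightarrow> norm (mat_prod w *v v) \<le> C)"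

lemma norm_vector_smult: "norm (k *s x) = norm k * norm x" for x :: "complex ^ 'n"
  by (simp add: norm_vec_def norm_mult L2_set_right_distrib)

text \<open>For each unit vector some word more than doubles its length, and the same word works on a
  neighbourhood. By compactness of the unit sphere finitely many words serve all vectors, and
  their lengths are bounded.\<close>

lemma doubling_words:
  assumes unbounded: "\<And>v. v \<noteq> 0 \<Longrightarrow> \<not> bounded_orbit B v"
  shows "\<exists>L. \<forall>v. \<exists>w. set w \<subseteq> B \<and> length w \<le> L \<and> 2 * norm v \<le> norm (mat_prod w *v v)"
proof -
  define U where "U l = (\<Union>w\<in>{w. set w \<subseteq> B \<and> length w \<le> l}. {v. 2 < norm (mat_prod w *v v)})"
    for l
  have "open {v. 2 < norm (mat_prod w *v v)}" for w :: "(complex ^ 'a ^ 'a) list"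
    by (intro open_Collect_less continuous_intros linear_continuous_on
        matrix_vector_mul_bounded_linear)
  then have U_open: "open (U l)" for l unfolding U_def by blast
  have cover: "sphere 0 1 \<subseteq> (\<Union>l\<in>UNIV. U l)"
  proof
    fix v :: "complex ^ 'a" assume "v \<in> sphere 0 1"
    then have "v \<noteq> 0" by auto
    then obtain w where "set w \<subseteq> B" "2 < norm (mat_prod w *v v)"
      using unbounded[of v] by (auto simp: bounded_orbit_def not_le)
    then show "v \<in> (\<Union>l\<in>UNIV. U l)" by (auto simp: U_def)
  qed
  then obtain I where I: "finite I" "sphere 0 1 \<subseteq> (\<Union>l\<in>I. U l)"
    by (rule compactE_image[OF compact_sphere U_open])
  have "\<exists>w. set w \<subseteq> B \<and> length w \<le> Max (insert 0 I) \<and> 2 * norm v \<le> norm (mat_prod w *v v)" for v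
  proof (cases "v = 0")
    case True
    then show ?thesis by (intro exI[of _ "[]"]) simp
  next
    case False
    define e where "e = (1 / norm v) *\<^sub>R v"
    have v: "v = norm v *\<^sub>R e" using False by (simp add: e_def)
    have "e \<in> sphere 0 1" using False by (simp add: e_def)
    then obtain l w where lw: "l \<in> I" "set w \<subseteq> B" "length w \<le> l" "2 < norm (mat_prod w *v e)"
      using I(2) by (auto simp: U_def)
    have "norm (mat_prod w *v v) = norm v * norm (mat_prod w *v e)"
      by (subst v) (simp add: linear_scale[OF matrix_vector_mul_linear])
    then have "2 * norm v \<le> norm (mat_prod w *v v)"
      using lw(4) by (simp add: mult.commute mult_left_mono)
    moreover have "length w \<le> Max (insert 0 I)"
      using lw I(1) by (meson Max_ge finite_insert insertCI order_trans)
    ultimately show ?thesis using lw(2) by blast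
  qed
  then show ?thesis by blast
qed

text \<open>If no nonzero vector had a bounded orbit, one could double the length of any vector again and
  again at the cost of at most \<open>L\<close> letters each time. This gives products of length at most
  \<open>k L\<close> and norm at least \<open>2 ^ k\<close>, which is exponential growth.\<close>

lemma exists_bounded_orbit:
  assumes "subexponential B"
  shows "\<exists>v. v \<noteq> 0 \<and> bounded_orbit B v"
proof (rule ccontr)
  assume no_orbit: "\<nexists>v. v \<noteq> 0 \<and> bounded_orbit B v"
  obtain L where L: "\<And>v. \<exists>w. set w \<subseteq> B \<and> length w \<le> L \<and> 2 * norm v \<le> norm (mat_prod w *v v)"
    using doubling_words[of B] no_orbit by blast
  define e :: "complex ^ 'a" where "e = axis undefined 1"
  have e: "norm e = 1" by (simp add: e_def)
  have iterate: "\<exists>w. set w \<subseteq> B \<and> length w \<le> k * L \<and> 2 ^ k \<le> norm (mat_prod w *v e)" for k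
  proof (induction k)
    case 0
    then show ?case using e by (intro exI[of _ "[]"]) simp
  next
    case (Suc k)
    then obtain w where w: "set w \<subseteq> B" "length w \<le> k * L" "2 ^ k \<le> norm (mat_prod w *v e)"
      by blast
    obtain u where "set u \<subseteq> B" "length u \<le> L"
      "2 * norm (mat_prod w *v e) \<le> norm (mat_prod u *v (mat_prod w *v e))"
      using L by blast
    with w show ?case
      by (intro exI[of _ "u @ w"]) (auto simp: mat_prod_append matrix_vector_mul_assoc)
  qed
  have "(2::real) \<le> 1"
  proof (rule le_1_if_powers_subexponential)
    fix s :: real assume s: "1 < s"
    \<comment> \<open>The root is taken with \<open>Suc L\<close> because \<open>L\<close> may be 0.\<close>
    define t where "t = root (Suc L) s"
    have t: "1 < t" "t ^ Suc L = s" using s by (simp_all add: t_def del: power_Suc)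
    obtain K where K: "\<And>w. set w \<subseteq> B \<Longrightarrow> mat_onorm (mat_prod w) \<le> K * t ^ length w"
      using subexponentialE[OF assms t(1)] by blast
    have K0: "0 \<le> K" using order_trans[OF mat_onorm_nonneg K[of "[]"]] by simp
    have "2 ^ k \<le> K * s ^ k" for k
    proof -
      obtain w where w: "set w \<subseteq> B" "length w \<le> k * L" "2 ^ k \<le> norm (mat_prod w *v e)"
        using iterate by blast
      note w(3)
      also have "norm (mat_prod w *v e) \<le> K * t ^ length w"
        using norm_mat_mult_le[of "mat_prod w" e] K[OF w(1)] e by simp
      also have "\<dots> \<le> K * t ^ (Suc L * k)"
        using w(2) t(1) K0 by (intro mult_left_mono power_increasing) (auto simp: mult.commute)
      also have "\<dots> = K * s ^ k" by (simp only: power_mult t(2))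
      finally show ?thesis .
    qed
    then show "\<exists>K. \<forall>k. 2 ^ k \<le> K * s ^ k" by blast
  qed simp
  then show False by simp
qed

text \<open>By Cramer's rule every \<open>x\<close> is a combination of \<open>v\<close> and \<open>u\<close> with coefficients bounded by a
  multiple of \<open>norm x\<close>.\<close>

lemma bounded_if_two_bounded_orbits:
  fixes B :: "(complex ^ 2 ^ 2) set"
  assumes "bounded_orbit B v" "bounded_orbit B u" and det: "v $ 1 * u $ 2 - v $ 2 * u $ 1 \<noteq> 0"
  obtains C where "\<And>w. set w \<subseteq> B \<Longrightarrow> mat_onorm (mat_prod w) \<le> C"
proof -
  define D where "D = v $ 1 * u $ 2 - v $ 2 * u $ 1"
  obtain Cv Cu where C: "\<And>w. set w \<subseteq> B \<Longrightarrow> norm (mat_prod w *v v) \<le> Cv"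
      "\<And>w. set w \<subseteq> B \<Longrightarrow> norm (mat_prod w *v u) \<le> Cu"
    using assms by (auto simp: bounded_orbit_def)
  have C0: "0 \<le> Cv" "0 \<le> Cu"
    using C[of "[]"] by (auto intro: order_trans[OF norm_ge_zero])
  have det_le: "norm (x $ 1 * y $ 2 - x $ 2 * y $ 1) \<le> 2 * norm x * norm y" for x y :: "complex ^ 2"
  proof -
    have "norm (x $ i * y $ j) \<le> norm x * norm y" for i j
      unfolding norm_mult by (intro mult_mono Finite_Cartesian_Product.norm_nth_le) auto
    from this[of 1 2] this[of 2 1] show ?thesis
      using norm_triangle_ineq4[of "x $ 1 * y $ 2" "x $ 2 * y $ 1"] by linarith
  qed
  have "mat_onorm (mat_prod w) \<le> (2 * norm u * Cv + 2 * norm v * Cu) / norm D"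
    if w: "set w \<subseteq> B" for w
  proof (rule mat_onorm_leI)
    fix x :: "complex ^ 2"
    let ?W = "mat_prod w"
    define \<alpha> \<beta> where "\<alpha> = x $ 1 * u $ 2 - x $ 2 * u $ 1" and "\<beta> = v $ 1 * x $ 2 - v $ 2 * x $ 1"
    have "D *s x = \<alpha> *s v + \<beta> *s u"
      by (simp add: vec_eq_iff forall_2 D_def \<alpha>_def \<beta>_def algebra_simps)
    then have "D *s (?W *v x) = \<alpha> *s (?W *v v) + \<beta> *s (?W *v u)"
      by (metis matrix_vector_right_distrib vector_scalar_commute)
    then have "norm D * norm (?W *v x) \<le> norm \<alpha> * norm (?W *v v) + norm \<beta> * norm (?W *v u)"
      by (metis norm_vector_smult norm_triangle_ineq)
    also have "\<dots> \<le> (2 * norm x * norm u) * Cv + (2 * norm v * norm x) * Cu"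
      unfolding \<alpha>_def \<beta>_def using C C0 w det_le by (intro add_mono mult_mono) auto
    finally show "norm (?W *v x) \<le> (2 * norm u * Cv + 2 * norm v * Cu) / norm D * norm x"
      using det by (simp add: D_def field_simps)
  qed
  then show ?thesis using that by blast
qed

text \<open>The vectors with bounded orbit form a subspace that is invariant under \<open>B\<close>. It is not zero,
  and when the products are unbounded it does not contain two independent vectors; so in
  dimension 2 it is a line.\<close>

lemma common_eigenvector:
  fixes B :: "(complex ^ 2 ^ 2) set"
  assumes "subexponential B" and unbounded: "\<nexists>C. \<forall>w. set w \<subseteq> B \<longrightarrow> mat_onorm (mat_prod w) \<le> C"
  obtains v where "v \<noteq> 0" "\<And>A. A \<in> B \<Longrightarrow> \<exists>a. A *v v = a *s v"
proof -
  obtain v where v: "v \<noteq> 0" "bounded_orbit B v" using exists_bounded_orbit assms(1) by blast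
  have "\<exists>a. A *v v = a *s v" if A: "A \<in> B" for A
  proof -
    obtain C where C: "\<And>w. set w \<subseteq> B \<Longrightarrow> norm (mat_prod w *v v) \<le> C"
      using v(2) by (auto simp: bounded_orbit_def)
    have "norm (mat_prod w *v (A *v v)) \<le> C" if "set w \<subseteq> B" for w
      using C[of "w @ [A]"] that A by (simp add: mat_prod_append matrix_vector_mul_assoc)
    then have "bounded_orbit B (A *v v)" by (auto simp: bounded_orbit_def)
    then have det: "v $ 1 * (A *v v) $ 2 = v $ 2 * (A *v v) $ 1"
      using bounded_if_two_bounded_orbits[OF v(2)] unbounded by (metis right_minus_eq)
    show ?thesis
    proof (cases "v $ 1 = 0")
      case True
      then have "v $ 2 \<noteq> 0" using v(1) by (auto simp: vec_eq_iff forall_2)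
      then have "A *v v = ((A *v v) $ 2 / v $ 2) *s v"
        using det True by (auto simp: vec_eq_iff forall_2)
      then show ?thesis ..
    next
      case False
      then have "A *v v = ((A *v v) $ 1 / v $ 1) *s v"
        using det by (auto simp: vec_eq_iff forall_2 field_simps)
      then show ?thesis ..
    qed
  qed
  then show ?thesis using v(1) that by blast
qed

section \<open>Upper right entries of products of upper triangular matrices\<close>

text \<open>The upper right entry of the product of the matrices with rows \<open>(a x, c x)\<close> and \<open>(0, d x)\<close>
  along a word.\<close>

primrec tri_offdiag :: "('i \<Rightarrow> complex) \<Rightarrow> ('i \<Rightarrow> complex) \<Rightarrow> ('i \<Rightarrow> complex) \<Rightarrow> 'i list \<Rightarrow> complex" where
  "tri_offdiag a c d [] = 0"
| "tri_offdiag a c d (x # w) = a x * tri_offdiag a c d w + c x * prod_list (map d w)"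

lemma tri_offdiag_append:
  "tri_offdiag a c d (u @ v) =
     prod_list (map a u) * tri_offdiag a c d v + tri_offdiag a c d u * prod_list (map d v)"
  by (induction u) (simp_all add: algebra_simps)

lemma tri_offdiag_replicate:
  assumes "a x = d x"
  shows "tri_offdiag a c d (replicate n x) = of_nat n * a x ^ (n - 1) * c x"
proof (induction n)
  case (Suc n)
  then show ?case using assms by (cases n) (simp_all add: algebra_simps)
qed simp

text \<open>Conjugation by the unipotent matrix with upper right entry \<open>t\<close> replaces \<open>c\<close> by
  \<open>c + t (a - d)\<close>.\<close>

lemma tri_offdiag_shift:
  "tri_offdiag a (\<lambda>x. c x + t * (a x - d x)) d w =
     tri_offdiag a c d w + t * (prod_list (map a w) - prod_list (map d w))"
proof (induction w)
  case (Cons x w)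
  show ?case unfolding tri_offdiag.simps Cons by (simp add: algebra_simps)
qed simp

lemma norm_prod_list_le_1:
  fixes f :: "'i \<Rightarrow> complex"
  assumes "\<And>x. x \<in> set w \<Longrightarrow> norm (f x) \<le> 1"
  shows "norm (prod_list (map f w)) \<le> 1"
  using assms by (induction w) (auto simp: norm_mult intro: mult_le_one)

lemma tri_offdiag_linear_bound:
  assumes "\<And>x. x \<in> set w \<Longrightarrow> norm (a x) \<le> 1 \<and> norm (d x) \<le> 1 \<and> norm (c x) \<le> K"
  shows "norm (tri_offdiag a c d w) \<le> K * length w"
  using assms
proof (induction w)
  case (Cons x w)
  have "norm (a x * tri_offdiag a c d w) \<le> 1 * (K * length w)"
    unfolding norm_mult using Cons by (intro mult_mono) auto
  moreover have "norm (c x * prod_list (map d w)) \<le> K * 1"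
    unfolding norm_mult using Cons.prems
    by (intro mult_mono norm_prod_list_le_1) (auto intro: order_trans[OF norm_ge_zero])
  ultimately show ?case
    by (simp add: algebra_simps norm_triangle_le)
qed simp

text \<open>The bound \<open>K (2 - |a| - |d|)\<close> on the upper right entry is stable under multiplication. For
  factors with diagonals of moduli \<open>p, q\<close> and \<open>r, s\<close> this is the inequality
  \<open>p (2 - r - s) + (2 - p - q) s \<le> 2 - p r - q s\<close>, in which the two sides differ by
  \<open>2 (1 - p) (1 - s)\<close>. The bound forces diagonal form on the letters with \<open>|a| = |d| = 1\<close>; on
  finitely many other letters it holds once \<open>K\<close> is large.\<close>

lemma tri_offdiag_bounded:
  assumes "\<And>x. x \<in> set w \<Longrightarrow> norm (a x) \<le> 1 \<and> norm (d x) \<le> 1 \<and>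
             norm (c x) \<le> K * (2 - norm (a x) - norm (d x))" and K: "0 \<le> K"
  shows "norm (tri_offdiag a c d w) \<le>
           K * (2 - norm (prod_list (map a w)) - norm (prod_list (map d w)))"
  using assms(1)
proof (induction w)
  case (Cons x w)
  define p q r s where "p = norm (a x)" and "q = norm (d x)"
    and "r = norm (prod_list (map a w))" and "s = norm (prod_list (map d w))"
  note norms = this
  have pq: "0 \<le> p" "p \<le> 1" "0 \<le> q" "q \<le> 1" using Cons.prems by (auto simp: norms)
  have rs: "0 \<le> r" "r \<le> 1" "0 \<le> s" "s \<le> 1"
    using Cons.prems by (auto simp: norms intro!: norm_prod_list_le_1)
  have "norm (tri_offdiag a c d (x # w)) \<le> p * norm (tri_offdiag a c d w) + norm (c x) * s"
    by (simp add: norms norm_mult[symmetric] norm_triangle_ineq)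
  also have "\<dots> \<le> p * (K * (2 - r - s)) + (K * (2 - p - q)) * s"
    using Cons pq rs by (intro add_mono mult_left_mono mult_right_mono) (auto simp: norms)
  also have "\<dots> = K * (2 - p * r - q * s) - 2 * (K * ((1 - p) * (1 - s)))"
    by (simp add: algebra_simps)
  also have "\<dots> \<le> K * (2 - p * r - q * s)"
    using pq rs K by simp
  finally show ?case by (simp add: norms norm_mult)
qed (use K in simp)

text \<open>Choose the signs so that either all real parts or all imaginary parts add up with the same
  sign; one of the two choices achieves half of the sum of the moduli.\<close>

lemma signed_sum_ge:
  fixes g :: "nat \<Rightarrow> complex"
  assumes "\<And>k. k < n \<Longrightarrow> norm (g k) = r"
  obtains e :: "nat \<Rightarrow> bool" where
    "n * r / 2 \<le> norm (\<Sum>k<n. if e k then g k else - g k)"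
proof -
  define eR where "eR k = (0 \<le> Re (g k))" for k
  define eI where "eI k = (0 \<le> Im (g k))" for k
  have "n * r = (\<Sum>k<n. norm (g k))" using assms by simp
  also have "\<dots> \<le> (\<Sum>k<n. \<bar>Re (g k)\<bar>) + (\<Sum>k<n. \<bar>Im (g k)\<bar>)"
    unfolding sum.distrib[symmetric] by (intro sum_mono cmod_le)
  also have "(\<Sum>k<n. \<bar>Re (g k)\<bar>) = Re (\<Sum>k<n. if eR k then g k else - g k)"
    unfolding Re_sum by (intro sum.cong) (auto simp: eR_def)
  also have "(\<Sum>k<n. \<bar>Im (g k)\<bar>) = Im (\<Sum>k<n. if eI k then g k else - g k)"
    unfolding Im_sum by (intro sum.cong) (auto simp: eI_def)
  also have "Re (\<Sum>k<n. if eR k then g k else - g k) \<le> norm (\<Sum>k<n. if eR k then g k else - g k)"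
    by (rule complex_Re_le_cmod)
  also have "Im (\<Sum>k<n. if eI k then g k else - g k) \<le> norm (\<Sum>k<n. if eI k then g k else - g k)"
    using abs_Im_le_cmod abs_le_D1 by blast
  finally show ?thesis using that[of eR] that[of eI] by linarith
qed

text \<open>The words \<open>xy\<close> and \<open>yx\<close> have the same diagonal \<open>(\<alpha>, \<beta>)\<close> and upper right entries
  \<open>m + \<delta>\<close> and \<open>m - \<delta>\<close>. A concatenation of \<open>n\<close> such blocks has the upper right entry
  \<open>\<Sum>k<n. \<alpha> ^ k * \<beta> ^ (n - 1 - k) * (m \<plusminus> \<delta>)\<close>, with one freely chosen sign for each block. As
  \<open>|\<alpha>| = |\<beta>| = 1\<close>, the signs can make the contribution \<open>X\<close> of \<open>\<delta>\<close> linear in \<open>n\<close>. The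
  contribution \<open>M\<close> of \<open>m\<close> might cancel it, but not both for \<open>X\<close> and for \<open>-X\<close>, and \<open>-X\<close> is
  obtained by flipping all signs.\<close>

lemma tri_offdiag_noncommuting:
  assumes unit: "norm (a x) = 1" "norm (d x) = 1" "norm (a y) = 1" "norm (d y) = 1"
  shows "\<exists>w. set w \<subseteq> {x, y} \<and> length w = 2 * n \<and>
     n * norm (tri_offdiag a c d [x, y] - tri_offdiag a c d [y, x]) / 4 \<le> norm (tri_offdiag a c d w)"
proof -
  define \<alpha> \<beta> where "\<alpha> = a x * a y" and "\<beta> = d x * d y"
  define m where "m = (tri_offdiag a c d [x, y] + tri_offdiag a c d [y, x]) / 2"
  define \<delta> where "\<delta> = (tri_offdiag a c d [x, y] - tri_offdiag a c d [y, x]) / 2"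
  define wd where "wd e n = concat (map (\<lambda>k. if e k then [x, y] else [y, x]) [0..<n])"
    for e :: "nat \<Rightarrow> bool" and n
  have set_wd: "set (wd e n) \<subseteq> {x, y}" for e n by (auto simp: wd_def split: if_splits)
  have len_wd: "length (wd e n) = 2 * n" for e n by (induction n) (auto simp: wd_def)
  have diag: "prod_list (map a (wd e n)) = \<alpha> ^ n" "prod_list (map d (wd e n)) = \<beta> ^ n" for e n
    by (induction n) (auto simp: wd_def \<alpha>_def \<beta>_def)
  have off_step: "tri_offdiag a c d (wd e (Suc n)) =
      \<alpha> ^ n * (m + (if e n then \<delta> else - \<delta>)) + tri_offdiag a c d (wd e n) * \<beta>" for e n
  proof -
    have "wd e (Suc n) = wd e n @ (if e n then [x, y] else [y, x])" by (simp add: wd_def)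
    then show ?thesis
      using diag(1)[of e n]
      by (auto simp: tri_offdiag_append m_def \<delta>_def \<beta>_def field_simps)
  qed
  have off: "tri_offdiag a c d (wd e n) =
      (\<Sum>k<n. \<alpha> ^ k * \<beta> ^ (n - 1 - k) * m) +
      (\<Sum>k<n. if e k then \<alpha> ^ k * \<beta> ^ (n - 1 - k) * \<delta> else - (\<alpha> ^ k * \<beta> ^ (n - 1 - k) * \<delta>))" for e n
  proof (induction n)
    case 0
    then show ?case by (simp add: wd_def)
  next
    case (Suc n)
    have pw: "\<beta> ^ (n - k) = \<beta> ^ (n - 1 - k) * \<beta>" if "k < n" for k
      using that by (metis Suc_diff_Suc diff_Suc_eq_diff_pred mult.commute power_Suc)
    have 1: "(\<Sum>k<n. \<alpha> ^ k * \<beta> ^ (n - k) * m) = (\<Sum>k<n. \<alpha> ^ k * \<beta> ^ (n - 1 - k) * m) * \<beta>"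
      unfolding sum_distrib_right by (intro sum.cong) (auto simp: pw)
    have 2: "(\<Sum>k<n. if e k then \<alpha> ^ k * \<beta> ^ (Suc n - 1 - k) * \<delta> else - (\<alpha> ^ k * \<beta> ^ (Suc n - 1 - k) * \<delta>)) =
      (\<Sum>k<n. if e k then \<alpha> ^ k * \<beta> ^ (n - 1 - k) * \<delta> else - (\<alpha> ^ k * \<beta> ^ (n - 1 - k) * \<delta>)) * \<beta>"
      unfolding sum_distrib_right by (intro sum.cong) (auto simp: pw)
    show ?case
      unfolding off_step Suc distrib_right 1[symmetric] 2[symmetric] by (simp add: algebra_simps)
  qed
  define g where "g k = \<alpha> ^ k * \<beta> ^ (n - 1 - k) * \<delta>" for k
  have "norm (g k) = norm \<delta>" for k
    using unit by (simp add: g_def \<alpha>_def \<beta>_def norm_mult norm_power)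
  then obtain e where e: "n * norm \<delta> / 2 \<le> norm (\<Sum>k<n. if e k then g k else - g k)"
    using signed_sum_ge[of n g "norm \<delta>"] by blast
  define X where "X = (\<Sum>k<n. if e k then g k else - g k)"
  define M where "M = (\<Sum>k<n. \<alpha> ^ k * \<beta> ^ (n - 1 - k) * m)"
  have plus: "tri_offdiag a c d (wd e n) = M + X"
    unfolding off M_def X_def g_def ..
  have "(\<Sum>k<n. if \<not> e k then g k else - g k) = - X"
    unfolding X_def sum_negf[symmetric] by (intro sum.cong) auto
  then have minus: "tri_offdiag a c d (wd (\<lambda>k. \<not> e k) n) = M - X"
    unfolding off M_def g_def by simp
  have "2 * norm X \<le> norm (M + X) + norm (M - X)"
  proof -
    have "norm ((M + X) - (M - X)) = 2 * norm X" by (simp add: norm_mult flip: mult_2)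
    then show ?thesis by (metis norm_triangle_ineq4)
  qed
  then have "norm X \<le> norm (M + X) \<or> norm X \<le> norm (M - X)" by linarith
  moreover have "n * norm (tri_offdiag a c d [x, y] - tri_offdiag a c d [y, x]) / 4 \<le> norm X"
    using e by (simp add: X_def \<delta>_def norm_divide)
  ultimately show ?thesis
    using set_wd len_wd plus minus by (metis order_trans)
qed

text \<open>Only the set \<open>U\<close> of letters with both diagonal entries of modulus 1 matters. Such a letter acts
  on \<open>\<complex>\<close> as the isometry \<open>z \<mapsto> (a z + c) / d\<close>. If these isometries have a common fixed point,
  conjugation moves it to 0, so that all letters in \<open>U\<close> become diagonal and the products are
  bounded by \<open>tri_offdiag_bounded\<close>. Otherwise either one of them is a nontrivial translation, whose powers grow
  linearly, or two of them do not commute.\<close>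

lemma tri_offdiag_dichotomy:
  assumes fin: "finite S" and le1: "\<And>x. x \<in> S \<Longrightarrow> norm (a x) \<le> 1 \<and> norm (d x) \<le> 1"
  shows "(\<exists>C. \<forall>w. set w \<subseteq> S \<longrightarrow> norm (tri_offdiag a c d w) \<le> C) \<or>
    (\<exists>\<delta>>0. \<forall>n. \<exists>w. set w \<subseteq> S \<and> length w = 2 * n \<and> \<delta> * n \<le> norm (tri_offdiag a c d w))"
proof -
  define U where "U = {x \<in> S. norm (a x) = 1 \<and> norm (d x) = 1}"
  consider (fixed_point) t where "\<forall>x\<in>U. c x + t * (a x - d x) = 0"
    | (jordan) x where "x \<in> U" "a x = d x" "c x \<noteq> 0"
    | (noncommuting) x y where "x \<in> U" "y \<in> U" "c y * (a x - d x) \<noteq> c x * (a y - d y)"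
  proof (cases "\<forall>x\<in>U. a x = d x")
    case True
    then show ?thesis using that(1)[of 0] that(2) by auto
  next
    case False
    then obtain x where x: "x \<in> U" "a x \<noteq> d x" by blast
    show ?thesis
    proof (cases "\<forall>y\<in>U. c y * (a x - d x) = c x * (a y - d y)")
      case True
      then have "\<forall>y\<in>U. c y + (- c x / (a x - d x)) * (a y - d y) = 0"
        using x by (auto simp: field_simps)
      then show ?thesis using that(1) by blast
    qed (use x that(3) in blast)
  qed
  then show ?thesis
  proof cases
    case fixed_point
    define c' where "c' x = c x + t * (a x - d x)" for x
    define gap where "gap x = 2 - norm (a x) - norm (d x)" for x
    \<comment> \<open>Terms with \<open>gap x = 0\<close> are 0 by the convention for division; there \<open>c' x = 0\<close> as well.\<close>
    define K where "K = (\<Sum>x\<in>S. norm (c' x) / gap x)"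
    have gap: "0 \<le> gap x" if "x \<in> S" for x using le1[OF that] by (simp add: gap_def)
    have K0: "0 \<le> K" unfolding K_def using gap by (intro sum_nonneg) auto
    have K: "norm (c' x) \<le> K * gap x" if "x \<in> S" for x
    proof (cases "gap x = 0")
      case True
      then have "x \<in> U" using le1[OF that] that by (auto simp: U_def gap_def)
      then show ?thesis using fixed_point True by (simp add: c'_def)
    next
      case False
      have "norm (c' x) / gap x \<le> K"
        unfolding K_def using fin that gap by (intro member_le_sum) auto
      then show ?thesis using gap[OF that] False by (simp add: field_simps)
    qed
    have "norm (tri_offdiag a c d w) \<le> 2 * K + 2 * norm t" if w: "set w \<subseteq> S" for w
    proof -
      define p q where "p = prod_list (map a w)" and "q = prod_list (map d w)"
      have pq: "norm p \<le> 1" "norm q \<le> 1"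
        using w le1 by (auto simp: p_def q_def intro!: norm_prod_list_le_1)
      have "norm (tri_offdiag a c' d w) \<le> K * (2 - norm p - norm q)"
        unfolding p_def q_def using w le1 K K0
        by (intro tri_offdiag_bounded) (auto simp: gap_def)
      also have "\<dots> \<le> K * 2" using K0 norm_ge_zero[of p] norm_ge_zero[of q]
        by (intro mult_left_mono) linarith+
      finally have "norm (tri_offdiag a c' d w) \<le> K * 2" .
      moreover have "tri_offdiag a c d w = tri_offdiag a c' d w - t * (p - q)"
        using tri_offdiag_shift[of a c t d w] by (simp add: c'_def[abs_def] p_def q_def)
      moreover have "norm (t * (p - q)) \<le> norm t * 2"
        unfolding norm_mult using pq norm_triangle_ineq4[of p q] by (intro mult_left_mono) auto
      ultimately show ?thesis
        using norm_triangle_ineq4[of "tri_offdiag a c' d w" "t * (p - q)"] by simp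
    qed
    then show ?thesis by blast
  next
    case jordan
    have "norm (c x) * n \<le> norm (tri_offdiag a c d (replicate (2 * n) x))" for n
      using jordan by (simp add: tri_offdiag_replicate norm_mult norm_power U_def mult.commute)
    moreover have "set (replicate (2 * n) x) \<subseteq> S" for n
      using jordan by (auto simp: U_def)
    ultimately show ?thesis using jordan(3) by (metis length_replicate zero_less_norm_iff)
  next
    case noncommuting
    define D where "D = norm (tri_offdiag a c d [x, y] - tri_offdiag a c d [y, x]) / 4"
    have "D > 0" using noncommuting(3) by (simp add: D_def algebra_simps)
    moreover have "\<exists>w. set w \<subseteq> S \<and> length w = 2 * n \<and> D * n \<le> norm (tri_offdiag a c d w)" for n
    proof -
      obtain w where "set w \<subseteq> {x, y}" "length w = 2 * n" "D * n \<le> norm (tri_offdiag a c d w)"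
        using tri_offdiag_noncommuting[of a x d y n c] noncommuting(1,2)
        by (auto simp: U_def D_def mult.commute)
      then show ?thesis using noncommuting(1,2) by (auto simp: U_def)
    qed
    ultimately show ?thesis by blast
  qed
qed

section \<open>Simultaneous triangularization\<close>

text \<open>Complete \<open>v\<close> to a basis; \<open>P\<close> has \<open>v\<close> as its first column.\<close>

lemma triangularizing_basis:
  fixes v :: "complex ^ 2"
  assumes "v \<noteq> 0"
  obtains P Q :: "complex ^ 2 ^ 2" where "P ** Q = mat 1" "Q ** P = mat 1"
    "\<And>A a. A *v v = a *s v \<Longrightarrow> (Q ** A ** P) $ 2 $ 1 = 0"
proof -
  have "\<exists>P::complex ^ 2 ^ 2. invertible P \<and> P *v axis 1 1 = v"
  proof (cases "v $ 1 = 0")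
    case True
    then have "v $ 2 \<noteq> 0" using assms by (auto simp: vec_eq_iff forall_2)
    with True show ?thesis
      by (intro exI[of _ "vector [vector [0, 1], vector [v $ 2, 0]]"])
         (simp add: invertible_det_nz det_2 vec_eq_iff forall_2 matrix_vector_mult_def sum_2 axis_def)
  next
    case False
    then show ?thesis
      by (intro exI[of _ "vector [vector [v $ 1, 0], vector [v $ 2, 1]]"])
         (simp add: invertible_det_nz det_2 vec_eq_iff forall_2 matrix_vector_mult_def sum_2 axis_def)
  qed
  then obtain P Q :: "complex ^ 2 ^ 2"
    where PQ: "P ** Q = mat 1" "Q ** P = mat 1" and P: "P *v axis 1 1 = v"
    by (auto simp: invertible_def)
  have Q: "Q *v v = axis 1 1"
    using PQ(2) by (simp add: P[symmetric] matrix_vector_mul_assoc)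
  have "(Q ** A ** P) $ 2 $ 1 = 0" if "A *v v = a *s v" for A a
  proof -
    have "(Q ** A ** P) *v axis 1 1 = a *s axis 1 1"
      using that P Q by (simp add: vector_scalar_commute flip: matrix_vector_mul_assoc)
    then have "((Q ** A ** P) *v axis 1 1) $ 2 = 0" by (simp add: axis_def)
    then show ?thesis by (simp add: matrix_vector_mult_def[of "Q ** A ** P"] sum_2 axis_def)
  qed
  with PQ that show ?thesis by blast
qed

lemma mat_prod_conjugate:
  assumes "P ** Q = mat 1" "Q ** P = mat 1"
  shows "mat_prod (map (\<lambda>A. Q ** A ** P) w) = Q ** mat_prod w ** P"
proof (induction w)
  case (Cons A w)
  have "Q ** A ** P ** (Q ** mat_prod w ** P) = Q ** A ** (P ** Q) ** mat_prod w ** P"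
    by (simp only: matrix_mul_assoc)
  with Cons assms show ?case by (simp add: matrix_mul_assoc)
qed (use assms in simp)

lemma upper_triangular_mat_prod:
  fixes T :: "'i \<Rightarrow> complex ^ 2 ^ 2"
  assumes "\<And>x. x \<in> set w \<Longrightarrow> T x $ 2 $ 1 = 0"
  defines "M \<equiv> mat_prod (map T w)"
  shows "M $ 1 $ 1 = prod_list (map (\<lambda>x. T x $ 1 $ 1) w)"
    and "M $ 1 $ 2 = tri_offdiag (\<lambda>x. T x $ 1 $ 1) (\<lambda>x. T x $ 1 $ 2) (\<lambda>x. T x $ 2 $ 2) w"
    and "M $ 2 $ 1 = 0"
    and "M $ 2 $ 2 = prod_list (map (\<lambda>x. T x $ 2 $ 2) w)"
  using assms(1) unfolding M_def
  by (induction w) (simp_all add: mat_def matrix_matrix_mult_def sum_2)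

text \<open>In a basis that starts with a common eigenvector all matrices are upper triangular. Their
  diagonal entries have modulus at most 1, because the powers of a diagonal entry are entries of
  products and grow subexponentially. Hence the norm of a product is determined, up to constants,
  by its upper right entry, which is at most linear in the length; since it is unbounded, the
  dichotomy for this entry provides products of linear size.\<close>

lemma unbounded_growth_is_linear:
  fixes B :: "(complex ^ 2 ^ 2) set"
  assumes fin: "finite B" and sub: "subexponential B"
    and unbounded: "\<nexists>C. \<forall>w. set w \<subseteq> B \<longrightarrow> mat_onorm (mat_prod w) \<le> C"
  obtains \<delta> C :: real where "0 < \<delta>"
    "\<And>w. set w \<subseteq> B \<Longrightarrow> mat_onorm (mat_prod w) \<le> C * (1 + length w)"
    "\<And>n. \<exists>w. set w \<subseteq> B \<and> length w = 2 * n \<and> \<delta> * n \<le> mat_onorm (mat_prod w)"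
proof -
  obtain v where v: "v \<noteq> 0" "\<And>A. A \<in> B \<Longrightarrow> \<exists>a. A *v v = a *s v"
    using common_eigenvector[OF sub unbounded] by blast
  obtain P Q :: "complex ^ 2 ^ 2" where PQ: "P ** Q = mat 1" "Q ** P = mat 1"
    and conj: "\<And>A a. A *v v = a *s v \<Longrightarrow> (Q ** A ** P) $ 2 $ 1 = 0"
    using triangularizing_basis[OF v(1)] by blast
  define T where "T A = Q ** A ** P" for A
  define a c d where "a A = T A $ 1 $ 1" and "c A = T A $ 1 $ 2" and "d A = T A $ 2 $ 2" for A
  define \<kappa> where "\<kappa> = mat_onorm P * mat_onorm Q"
  have \<kappa>0: "0 \<le> \<kappa>" by (simp add: \<kappa>_def mat_onorm_nonneg)
  have prod_T: "mat_prod (map T w) = Q ** mat_prod w ** P" for w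
    unfolding T_def using PQ by (rule mat_prod_conjugate)
  have onorm_T: "mat_onorm (mat_prod (map T w)) \<le> \<kappa> * mat_onorm (mat_prod w)" for w
  proof -
    have "mat_onorm (Q ** mat_prod w ** P) \<le> (mat_onorm Q * mat_onorm (mat_prod w)) * mat_onorm P"
      by (meson mat_onorm_mult mat_onorm_nonneg mult_right_mono order_trans)
    then show ?thesis by (simp add: prod_T \<kappa>_def mult_ac)
  qed
  have onorm_W: "mat_onorm (mat_prod w) \<le> \<kappa> * mat_onorm (mat_prod (map T w))" for w
  proof -
    have "mat_prod w = (P ** Q) ** mat_prod w ** (P ** Q)" using PQ by simp
    also have "\<dots> = P ** mat_prod (map T w) ** Q" by (simp add: prod_T matrix_mul_assoc)
    finally have "mat_onorm (mat_prod w) = mat_onorm (P ** mat_prod (map T w) ** Q)" by simp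
    also have "\<dots> \<le> (mat_onorm P * mat_onorm (mat_prod (map T w))) * mat_onorm Q"
      by (meson mat_onorm_mult mat_onorm_nonneg mult_right_mono order_trans)
    finally show ?thesis by (simp add: \<kappa>_def mult_ac)
  qed
  have T21: "T A $ 2 $ 1 = 0" if "A \<in> B" for A
    using v(2)[OF that] conj by (auto simp: T_def)
  have entries: "mat_prod (map T w) $ 1 $ 1 = prod_list (map a w)"
    "mat_prod (map T w) $ 1 $ 2 = tri_offdiag a c d w"
    "mat_prod (map T w) $ 2 $ 1 = 0"
    "mat_prod (map T w) $ 2 $ 2 = prod_list (map d w)" if "set w \<subseteq> B" for w
    using upper_triangular_mat_prod[of w T] T21 that by (auto simp: a_def[abs_def] c_def[abs_def] d_def[abs_def])
  have diag_le_1: "norm (a A) \<le> 1 \<and> norm (d A) \<le> 1" if A: "A \<in> B" for A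
  proof -
    have "\<exists>K. \<forall>n. norm (a A) ^ n \<le> K * s ^ n \<and> norm (d A) ^ n \<le> K * s ^ n" if s: "1 < s" for s
    proof -
      obtain K where K: "\<And>w. set w \<subseteq> B \<Longrightarrow> mat_onorm (mat_prod w) \<le> K * s ^ length w"
        using subexponentialE[OF sub s] by blast
      have "norm (a A) ^ n \<le> \<kappa> * K * s ^ n \<and> norm (d A) ^ n \<le> \<kappa> * K * s ^ n" for n
      proof -
        have w: "set (replicate n A) \<subseteq> B" using A by auto
        let ?M = "mat_prod (map T (replicate n A))"
        have "mat_onorm ?M \<le> \<kappa> * K * s ^ n"
          using onorm_T[of "replicate n A"] mult_left_mono[OF K[OF w] \<kappa>0] by simp
        then show ?thesis
          using entries(1,4)[OF w] norm_entry_le_mat_onorm[of ?M 1 1] norm_entry_le_mat_onorm[of ?M 2 2]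
          by (simp add: norm_power)
      qed
      then show ?thesis by blast
    qed
    then show ?thesis
      using le_1_if_powers_subexponential[of "norm (a A)"] le_1_if_powers_subexponential[of "norm (d A)"]
      by (meson norm_ge_zero)
  qed
  have onorm_le: "mat_onorm (mat_prod w) \<le> \<kappa> * (2 + norm (tri_offdiag a c d w))" if w: "set w \<subseteq> B" for w
  proof -
    have "norm (prod_list (map a w)) \<le> 1" "norm (prod_list (map d w)) \<le> 1"
      using diag_le_1 w by (auto intro!: norm_prod_list_le_1)
    then have "mat_onorm (mat_prod (map T w)) \<le> 2 + norm (tri_offdiag a c d w)"
      using mat_onorm_le_sum_entries[of "mat_prod (map T w)"] entries[OF w] by (simp add: sum_2)
    then show ?thesis by (rule order_trans[OF onorm_W mult_left_mono[OF _ \<kappa>0]])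
  qed
  have "\<nexists>C. \<forall>w. set w \<subseteq> B \<longrightarrow> norm (tri_offdiag a c d w) \<le> C"
  proof
    assume "\<exists>C. \<forall>w. set w \<subseteq> B \<longrightarrow> norm (tri_offdiag a c d w) \<le> C"
    then obtain C where C: "\<And>w. set w \<subseteq> B \<Longrightarrow> norm (tri_offdiag a c d w) \<le> C" by blast
    have "mat_onorm (mat_prod w) \<le> \<kappa> * (2 + C)" if "set w \<subseteq> B" for w
      by (rule order_trans[OF onorm_le[OF that] mult_left_mono[OF add_left_mono[OF C[OF that]] \<kappa>0]])
    then show False using unbounded by blast
  qed
  then obtain \<delta> where \<delta>: "0 < \<delta>"
    "\<And>n. \<exists>w. set w \<subseteq> B \<and> length w = 2 * n \<and> \<delta> * n \<le> norm (tri_offdiag a c d w)"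
    using tri_offdiag_dichotomy[OF fin, of a d c] diag_le_1 by blast
  have \<kappa>: "0 < \<kappa>"
  proof (rule ccontr)
    assume "\<not> 0 < \<kappa>"
    then have "\<forall>w. set w \<subseteq> B \<longrightarrow> mat_onorm (mat_prod w) \<le> 0" using \<kappa>0 onorm_W by auto
    then show False using unbounded by blast
  qed
  have lower: "\<exists>w. set w \<subseteq> B \<and> length w = 2 * n \<and> \<delta> / \<kappa> * n \<le> mat_onorm (mat_prod w)" for n
  proof -
    obtain w where w: "set w \<subseteq> B" "length w = 2 * n" "\<delta> * n \<le> norm (tri_offdiag a c d w)"
      using \<delta>(2) by blast
    have "\<delta> * n \<le> \<kappa> * mat_onorm (mat_prod w)"
      using w(3) norm_entry_le_mat_onorm[of "mat_prod (map T w)" 1 2] onorm_T[of w]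
      by (simp add: entries(2)[OF w(1)])
    then show ?thesis using w \<kappa> by (intro exI[of _ w]) (simp add: field_simps)
  qed
  define K where "K = (\<Sum>A\<in>B. norm (c A))"
  have K0: "0 \<le> K" unfolding K_def by (intro sum_nonneg) simp
  have "mat_onorm (mat_prod w) \<le> \<kappa> * (2 + K) * (1 + length w)" if w: "set w \<subseteq> B" for w
  proof -
    have "norm (tri_offdiag a c d w) \<le> K * length w"
      using w diag_le_1 fin unfolding K_def
      by (intro tri_offdiag_linear_bound) (auto intro!: member_le_sum)
    then have "2 + norm (tri_offdiag a c d w) \<le> (2 + K) * (1 + length w)"
      using K0 by (simp add: algebra_simps)
    from order_trans[OF onorm_le[OF w] mult_left_mono[OF this \<kappa>0]]
    show ?thesis by (simp only: mult.assoc)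
  qed
  from divide_pos_pos[OF \<delta>(1) \<kappa>] this lower show ?thesis by (rule that)
qed

section \<open>The dichotomy\<close>

theorem corollary1p1:
  fixes B :: "(complex ^ 2 ^ 2) set"
  assumes "finite B" and "B \<noteq> {}"
    and "joint_spectral_radius B \<noteq> 0"
  shows "bounded_away_zero_infinity
           (\<lambda>n. max_prod_norm B n / joint_spectral_radius B ^ n) \<or>
         bounded_away_zero_infinity
           (\<lambda>n. max_prod_norm B n / (real n * joint_spectral_radius B ^ n))"
proof -
  define \<rho> where "\<rho> = joint_spectral_radius B"
  have \<rho>: "0 < \<rho>"
    using joint_spectral_radius_growth(1)[OF assms(1,2)] assms(3) by (simp add: \<rho>_def)
  \<comment> \<open>Dividing all matrices by \<open>\<rho>\<close> reduces to joint spectral radius 1; then \<open>b n \<ge> 1\<close>.\<close>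
  define B' where "B' = (*\<^sub>R) (1 / \<rho>) ` B"
  have B': "finite B'" "B' \<noteq> {}" using assms by (auto simp: B'_def)
  define b where "b = max_prod_norm B'"
  have b: "b n = max_prod_norm B n / \<rho> ^ n" for n
    using max_prod_norm_scaleR[OF assms(1,2), of "1 / \<rho>" n] \<rho>
    by (simp add: b_def B'_def power_divide)
  have b_ge_1: "1 \<le> b n" if "1 \<le> n" for n
    using joint_spectral_radius_growth(2)[OF assms(1,2), of n] that \<rho>
    by (simp add: b \<rho>_def[symmetric])
  have onorm_le_b: "mat_onorm (mat_prod w) \<le> b (length w)" if "set w \<subseteq> B'" for w
    unfolding b_def using that B'(1) by (intro mat_onorm_le_max_prod_norm) (auto simp: words_def)
  have b_leI: "b n \<le> C" if "\<And>w. set w \<subseteq> B' \<Longrightarrow> length w = n \<Longrightarrow> mat_onorm (mat_prod w) \<le> C" for n C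
    unfolding b_def max_prod_norm_le_iff[OF B'] using that by (auto simp: words_def)
  have sub: "subexponential B'"
    unfolding subexponential_def
  proof (intro allI impI)
    fix s :: real assume "1 < s"
    then have "\<rho> < s * \<rho>" using \<rho> by simp
    then obtain K where K: "\<And>n. max_prod_norm B n \<le> K * (s * \<rho>) ^ n"
      using joint_spectral_radius_growth(3)[OF assms(1,2)] by (auto simp: \<rho>_def)
    have "b n \<le> K * s ^ n" for n
      using K[of n] \<rho> by (simp add: b field_simps)
    then have "mat_onorm (mat_prod w) \<le> K * s ^ length w" if "set w \<subseteq> B'" for w
      using onorm_le_b[OF that] by (rule order_trans[rotated])
    then show "\<exists>K. \<forall>w. set w \<subseteq> B' \<longrightarrow> mat_onorm (mat_prod w) \<le> K * s ^ length w"
      by blast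
  qed
  show ?thesis
  proof (cases "\<exists>C. \<forall>w. set w \<subseteq> B' \<longrightarrow> mat_onorm (mat_prod w) \<le> C")
    case True
    then obtain C where "\<And>w. set w \<subseteq> B' \<Longrightarrow> mat_onorm (mat_prod w) \<le> C" by blast
    then have C: "b n \<le> C" for n by (intro b_leI)
    have "1 \<le> C" using C[of 1] b_ge_1[of 1] by simp
    then have "bounded_away_zero_infinity b"
      unfolding bounded_away_zero_infinity_def using C b_ge_1 by (intro exI[of _ 1] exI[of _ C]) auto
    then show ?thesis by (simp add: b[abs_def] \<rho>_def)
  next
    case False
    obtain \<delta> C :: real where \<delta>: "0 < \<delta>"
      and upper: "\<And>w. set w \<subseteq> B' \<Longrightarrow> mat_onorm (mat_prod w) \<le> C * (1 + length w)"
      and lower: "\<And>n. \<exists>w. set w \<subseteq> B' \<and> length w = 2 * n \<and> \<delta> * n \<le> mat_onorm (mat_prod w)"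
      using unbounded_growth_is_linear[OF B'(1) sub False] by metis
    have b_upper: "b n \<le> C * (1 + n)" for n
      using upper by (intro b_leI) auto
    have C0: "0 \<le> C" using b_upper[of 1] b_ge_1[of 1] by simp
    have b_even: "\<delta> * n \<le> b (2 * n)" for n
    proof -
      obtain w where "set w \<subseteq> B'" "length w = 2 * n" "\<delta> * n \<le> mat_onorm (mat_prod w)"
        using lower by blast
      then show ?thesis using onorm_le_b[of w] by simp
    qed
    have b_submult: "b (m + n) \<le> b m * b n" for m n
      unfolding b_def by (rule max_prod_norm_submult[OF B'])
    define c where "c = \<delta> / (2 * b 1)"
    have b1: "1 \<le> b 1" using b_ge_1 by simp
    have c: "0 < c" using \<delta> b1 by (simp add: c_def)
    have ratio: "c \<le> b n / n \<and> b n / n \<le> 2 * C" if n: "1 \<le> n" for n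
    proof
      have "C * (1 + n) \<le> 2 * C * n"
        using C0 n mult_left_mono[of 1 "real n" C] by (simp add: algebra_simps)
      then show "b n / n \<le> 2 * C"
        using b_upper[of n] n by (simp add: divide_le_eq)
      \<comment> \<open>An odd length is compared with the next even one, at the cost of a factor \<open>b 1\<close>.\<close>
      have "\<delta> * n \<le> 2 * b 1 * b n"
      proof (cases "even n")
        case True
        then obtain m where "n = 2 * m" by blast
        then have "\<delta> * n \<le> 2 * b n" using b_even[of m] by simp
        also have "\<dots> \<le> 2 * b 1 * b n" using b1 b_ge_1[OF n] by simp
        finally show ?thesis .
      next
        case False
        then obtain m where m: "n = 2 * m + 1" by (elim oddE)
        have "\<delta> * n \<le> 2 * (\<delta> * (m + 1))" using \<delta> by (simp add: m algebra_simps)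
        also have "\<dots> \<le> 2 * b (n + 1)" using b_even[of "m + 1"] by (simp add: m)
        also have "\<dots> \<le> 2 * b 1 * b n" using b_submult[of n 1] by (simp add: mult.commute)
        finally show ?thesis .
      qed
      then show "c \<le> b n / n" using n b1 by (simp add: c_def field_simps)
    qed
    have "bounded_away_zero_infinity (\<lambda>n. b n / n)"
      unfolding bounded_away_zero_infinity_def using c ratio ratio[of 1]
      by (intro exI[of _ c] exI[of _ "2 * C"]) auto
    then show ?thesis by (simp add: b \<rho>_def mult.commute)
  qed
qed

end
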